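(* Let $X_1,\dots,X_n$ be independent random variables on $E$ with distributions $\mu_1,\dots,\mu_n$. Let $\psi:E\to\mathbb{R}$ be a diffeomorphism such that $\psi(X_i)\in[a_i,b_i]$ almost surely for each $i$. Then for any function $f:E^n\to\mathbb{R}$ that is $\psi$-Lipschitz with constant $L$, and every $t>0$, $$\mathbb{P}\big(f(X_1,\dots,X_n)-\mathbb{E}[f(X_1,\dots,X_n)]\ge t\big)\le \exp\left(-\frac{2t^2}{L^2\sum_{i=1}^n(b_i-a_i)^2}\right).$$
   Context: Convention: a "diffeomorphism" $\psi:E\to F$ between measurable spaces means a measurable bijection with measurable inverse; $\mathbb{R}$ carries its Borel $\sigma$-algebra. The map $\psi$ acts on $E^n$ coordinatewise: $\psi(x_1,\dots,x_n)=(\psi(x_1),\dots,\psi(x_n))\in\mathbb{R}^n$. A function $f:E^n\to\mathbb{R}$ is $\psi$-Lipschitz with constant $L$ if $|f(x)-f(y)|\le L\,\|\psi(x)-\psi(y)\|_2$ for all $x,y\in E^n$, where $\|\cdot\|_2$ is the Euclidean norm on $\mathbb{R}^n$. *)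

theory Defs
  imports "HOL-Probability.Probability"
begin

text \<open>
  A ``diffeomorphism'' is understood in the measurable sense only; no smoothness is involved.
\<close>

definition diffeomorphism :: "'e measure \<Rightarrow> 'f measure \<Rightarrow> ('e \<Rightarrow> 'f) \<Rightarrow> bool" where
  "diffeomorphism E F \<psi> \<longleftrightarrow>
     \<psi> \<in> measurable E F \<and>
     bij_betw \<psi> (space E) (space F) \<and>
     inv_into (space E) \<psi> \<in> measurable F E"

text \<open>
  Points of \<open>E\<^sup>n\<close> are the extensional functions on \<open>{1..n}\<close> with values in \<open>space E\<close>, that is, the
  elements of the product space \<open>Pi\<^sub>M {1..n} (\<lambda>_. E)\<close>.
\<close>

definition psi_lipschitz ::
    "nat \<Rightarrow> 'e measure \<Rightarrow> ('e \<Rightarrow> real) \<Rightarrow> real \<Rightarrow> ((nat \<Rightarrow> 'e) \<Rightarrow> real) \<Rightarrow> bool" where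
  "psi_lipschitz n E \<psi> L f \<longleftrightarrow>
     (\<forall>x \<in> space (Pi\<^sub>M {1..n} (\<lambda>_. E)). \<forall>y \<in> space (Pi\<^sub>M {1..n} (\<lambda>_. E)).
        \<bar>f x - f y\<bar> \<le> L * L2_set (\<lambda>i. \<psi> (x i) - \<psi> (y i)) {1..n})"

text \<open>
  \<open>exp (- u / v)\<close> for \<open>u > 0\<close> and \<open>v \<ge> 0\<close>, with the limit value \<open>0\<close> at \<open>v = 0\<close>. Since \<open>u / 0 = 0\<close>
  in HOL, the plain expression would be \<open>1\<close> there, and the tail bound would become void when \<open>L = 0\<close>
  or all the intervals are points.
\<close>

definition exp_neg_quot :: "real \<Rightarrow> real \<Rightarrow> real" where
  "exp_neg_quot u v = (if v = 0 then 0 else exp (- u / v))"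

end

theory Submission
  imports Defs "HOL-Real_Asymp.Real_Asymp"
begin

text \<open>
  The theorem is a case of McDiarmid's inequality. Clamping each \<open>\<psi> (X\<^sub>i)\<close> to \<open>[a\<^sub>i, b\<^sub>i]\<close> changes
  \<open>f (X\<^sub>1, \<dots>, X\<^sub>n)\<close> only on a null set, and turns \<open>f\<close> into a function on the product space in which
  changing the \<open>i\<close>-th coordinate moves the value by at most \<open>\<bar>L\<bar> (b\<^sub>i - a\<^sub>i)\<close> everywhere. For such a
  function, integrating out one coordinate at a time and applying Hoeffding's lemma to each bounds the
  centred moment generating function, and a Chernoff bound gives the tail. Measurability of \<open>f\<close>
  comes from the Lipschitz condition, which makes \<open>f\<close> continuous in the coordinates \<open>\<psi>\<close>.
\<close>

section \<open>Exponential moments and tails under bounded differences\<close>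

text \<open>With \<open>m\<close> the infimum of \<open>h\<close>, all values lie in the interval
  from \<open>m\<close> to \<open>m + c\<close>. Hoeffding's lemma sees only the length
  \<open>c\<close>, so no explicit endpoints have to be known.\<close>

lemma nn_integral_exp_oscillation:
  fixes h :: "'e \<Rightarrow> real"
  assumes "prob_space N"
    and h [measurable]: "h \<in> borel_measurable N"
    and osc: "\<And>y z. y \<in> space N \<Longrightarrow> z \<in> space N \<Longrightarrow> \<bar>h y - h z\<bar> \<le> c"
    and "s > 0"
  shows "(\<integral>\<^sup>+y. exp (s * (h y - (\<integral>y. h y \<partial>N))) \<partial>N) \<le> exp (s\<^sup>2 * c\<^sup>2 / 8)"
proof -
  interpret prob_space N by fact
  obtain y0 where y0: "y0 \<in> space N" using not_empty by blast
  define m where "m = (INF y\<in>space N. h y)"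
  have bdd: "bdd_below (h ` space N)"
  proof (rule bdd_belowI2)
    fix y assume "y \<in> space N"
    then show "h y0 - c \<le> h y" using osc[OF y0, of y] by linarith
  qed
  have lo: "m \<le> h y" if "y \<in> space N" for y
    unfolding m_def using bdd that by (rule cINF_lower)
  have hi: "h y \<le> m + c" if y: "y \<in> space N" for y
  proof -
    have "h y - c \<le> m"
      unfolding m_def
    proof (rule cINF_greatest)
      fix z assume "z \<in> space N"
      then show "h y - c \<le> h z" using osc[OF y, of z] by linarith
    qed (use y0 in auto)
    then show ?thesis by simp
  qed
  interpret interval_bounded_random_variable N h m "m + c"
    by unfold_locales (use lo hi in auto)
  show ?thesis using Hoeffdings_lemma_nn_integral[OF \<open>s > 0\<close>] by simp
qed

text \<open>Integrating out one coordinate \<open>i\<close> gives \<open>G\<close>, which inherits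
  the bound \<open>B\<close> and the constants \<open>c j\<close> of the other coordinates. In the
  splitting \<open>f - E = (f - G) + (G - E)\<close>, the first term is centred with oscillation at
  most \<open>c i\<close> in coordinate \<open>i\<close>, and the second falls under the induction
  hypothesis. The bound \<open>B\<close> makes \<open>f\<close> and its slices integrable; the
  nonnegative integral spares the same argument for the exponentials.\<close>

lemma nn_integral_exp_bounded_differences:
  fixes f :: "('i \<Rightarrow> 'e) \<Rightarrow> real"
  assumes N: "\<And>i. prob_space (N i)"
    and "finite I"
    and "f \<in> borel_measurable (Pi\<^sub>M I N)"
    and "\<And>x. x \<in> space (Pi\<^sub>M I N) \<Longrightarrow> \<bar>f x\<bar> \<le> B"
    and "\<And>i x y. i \<in> I \<Longrightarrow> x \<in> space (Pi\<^sub>M I N) \<Longrightarrow> y \<in> space (N i) \<Longrightarrow>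
           \<bar>f (x(i := y)) - f x\<bar> \<le> c i"
    and s: "s > 0"
  shows "(\<integral>\<^sup>+x. exp (s * (f x - (\<integral>x. f x \<partial>Pi\<^sub>M I N))) \<partial>Pi\<^sub>M I N)
         \<le> exp (s\<^sup>2 * (\<Sum>i\<in>I. (c i)\<^sup>2) / 8)"
proof -
  interpret product_sigma_finite N
    by (simp add: N product_sigma_finite_def prob_space_imp_sigma_finite)
  show ?thesis
    using assms(2-5)
  proof (induction I arbitrary: f rule: finite_induct)
    case empty
    then show ?case
      by (simp add: PiM_empty nn_integral_count_space_finite lebesgue_integral_count_space_finite)
  next
    case (insert i I f)
    note [measurable] = insert.prems(1)
    define G where "G x = (\<integral>y. f (x(i := y)) \<partial>N i)" for x
    have upd: "x(i := y) \<in> space (Pi\<^sub>M (insert i I) N)"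
      if "x \<in> space (Pi\<^sub>M I N)" "y \<in> space (N i)" for x y
      using that by (simp add: space_PiM PiE_fun_upd)
    interpret P: prob_space "Pi\<^sub>M (insert i I) N" by (rule prob_space_PiM) (rule N)
    interpret Ni: prob_space "N i" by (rule N)
    have meas_slice [measurable]: "(\<lambda>y. f (x(i := y))) \<in> borel_measurable (N i)"
      if "x \<in> space (Pi\<^sub>M I N)" for x
      using that insert.hyps by measurable
    have int_slice: "integrable (N i) (\<lambda>y. f (x(i := y)))" if "x \<in> space (Pi\<^sub>M I N)" for x
      by (rule Ni.integrable_const_bound[where B = B]) (use that upd insert.prems(2) in auto)
    have [measurable]: "G \<in> borel_measurable (Pi\<^sub>M I N)"
      unfolding G_def by measurable
    have G_bound: "\<bar>G x\<bar> \<le> B" if "x \<in> space (Pi\<^sub>M I N)" for x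
    proof -
      have "\<bar>G x\<bar> \<le> (\<integral>y. \<bar>f (x(i := y))\<bar> \<partial>N i)"
        unfolding G_def by (rule integral_abs_bound)
      also have "\<dots> \<le> B"
        using int_slice[OF that] upd[OF that] insert.prems(2)
        by (intro Ni.integral_le_const) auto
      finally show ?thesis .
    qed
    have G_diff: "\<bar>G (x(j := z)) - G x\<bar> \<le> c j"
      if j: "j \<in> I" and x: "x \<in> space (Pi\<^sub>M I N)" and z: "z \<in> space (N j)" for j x z
    proof -
      have x': "x(j := z) \<in> space (Pi\<^sub>M I N)"
        using j x z by (auto simp: space_PiM PiE_def extensional_def)
      have ij: "i \<noteq> j" using j insert.hyps by auto
      have "G (x(j := z)) - G x = (\<integral>y. f (x(j := z, i := y)) - f (x(i := y)) \<partial>N i)"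
        unfolding G_def using int_slice[OF x] int_slice[OF x'] by simp
      also have "\<bar>\<dots>\<bar> \<le> (\<integral>y. \<bar>f (x(j := z, i := y)) - f (x(i := y))\<bar> \<partial>N i)"
        by (rule integral_abs_bound)
      also have "\<dots> \<le> c j"
      proof (rule Ni.integral_le_const)
        show "integrable (N i) (\<lambda>y. \<bar>f (x(j := z, i := y)) - f (x(i := y))\<bar>)"
          using int_slice[OF x] int_slice[OF x'] by simp
        show "AE y in N i. \<bar>f (x(j := z, i := y)) - f (x(i := y))\<bar> \<le> c j"
        proof (rule AE_I2)
          fix y assume y: "y \<in> space (N i)"
          \<comment> \<open>The bounded difference at \<open>j\<close> is applied at the base point
            \<open>x(i := y)\<close>, so \<open>j\<close> is updated last; the two updates commute
            because \<open>i\<close> and \<open>j\<close> differ.\<close>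
          have "\<bar>f (x(i := y, j := z)) - f (x(i := y))\<bar> \<le> c j"
            by (rule insert.prems(3)[OF insertI2[OF j] upd[OF x y] z])
          then show "\<bar>f (x(j := z, i := y)) - f (x(i := y))\<bar> \<le> c j"
            by (simp only: fun_upd_twist[OF ij])
        qed
      qed
      finally show ?thesis .
    qed
    define E where "E = (\<integral>x. G x \<partial>Pi\<^sub>M I N)"
    have "integrable (Pi\<^sub>M (insert i I) N) f"
      by (rule P.integrable_const_bound[where B = B]) (use insert.prems in auto)
    then have E: "(\<integral>x. f x \<partial>Pi\<^sub>M (insert i I) N) = E"
      unfolding E_def G_def using insert.hyps by (intro product_integral_insert)
    have inner: "(\<integral>\<^sup>+y. exp (s * (f (x(i := y)) - G x)) \<partial>N i) \<le> exp (s\<^sup>2 * (c i)\<^sup>2 / 8)"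
      if x: "x \<in> space (Pi\<^sub>M I N)" for x
      unfolding G_def
    proof (rule nn_integral_exp_oscillation[OF N meas_slice[OF x] _ s])
      fix y z assume y: "y \<in> space (N i)" and z: "z \<in> space (N i)"
      \<comment> \<open>Two points of the same slice differ by one update at \<open>i\<close>:
        writing \<open>y\<close> over \<open>z\<close> turns one into the other.\<close>
      have "\<bar>f ((x(i := z))(i := y)) - f (x(i := z))\<bar> \<le> c i"
        by (rule insert.prems(3)[OF insertI1 upd[OF x z] y])
      then show "\<bar>f (x(i := y)) - f (x(i := z))\<bar> \<le> c i"
        by (simp only: fun_upd_upd)
    qed
    have "(\<integral>\<^sup>+x. exp (s * (f x - E)) \<partial>Pi\<^sub>M (insert i I) N)
        = (\<integral>\<^sup>+x. (\<integral>\<^sup>+y. exp (s * (f (x(i := y)) - E)) \<partial>N i) \<partial>Pi\<^sub>M I N)"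
      by (rule product_nn_integral_insert[OF insert.hyps(1,2)]) measurable
    \<comment> \<open>The factor \<open>exp (s * (G x - E))\<close> does not depend on
      \<open>y\<close> and leaves the inner integral.\<close>
    also have "\<dots> = (\<integral>\<^sup>+x. ennreal (exp (s * (G x - E))) *
                     (\<integral>\<^sup>+y. exp (s * (f (x(i := y)) - G x)) \<partial>N i) \<partial>Pi\<^sub>M I N)"
      by (intro nn_integral_cong)
        (simp add: nn_integral_cmult[symmetric] ennreal_mult[symmetric] exp_add[symmetric]
          algebra_simps)
    also have "\<dots> \<le> (\<integral>\<^sup>+x. ennreal (exp (s * (G x - E))) * exp (s\<^sup>2 * (c i)\<^sup>2 / 8) \<partial>Pi\<^sub>M I N)"
      by (intro nn_integral_mono mult_left_mono inner) auto
    also have "\<dots> = (\<integral>\<^sup>+x. exp (s * (G x - E)) \<partial>Pi\<^sub>M I N) * exp (s\<^sup>2 * (c i)\<^sup>2 / 8)"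
      by (rule nn_integral_multc) measurable
    also have "\<dots> \<le> ennreal (exp (s\<^sup>2 * (\<Sum>i\<in>I. (c i)\<^sup>2) / 8)) * exp (s\<^sup>2 * (c i)\<^sup>2 / 8)"
      unfolding E_def by (intro mult_right_mono insert.IH G_bound G_diff) auto
    also have "\<dots> = exp (s\<^sup>2 * (\<Sum>i\<in>insert i I. (c i)\<^sup>2) / 8)"
      using insert.hyps
      by (simp add: ennreal_mult[symmetric] exp_add[symmetric] distrib_left add_divide_distrib
          add.commute)
    finally show ?case unfolding E .
  qed
qed

text \<open>The Chernoff bound holds for every \<open>s > 0\<close>. It is optimised in
  \<open>s\<close> when the variance proxy is positive, and \<open>s\<close> is sent to infinity
  when it vanishes.\<close>

lemma bounded_differences_tail:
  fixes f :: "('i \<Rightarrow> 'e) \<Rightarrow> real"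
  assumes N: "\<And>i. prob_space (N i)"
    and I: "finite I"
    and f [measurable]: "f \<in> borel_measurable (Pi\<^sub>M I N)"
    and bdd: "\<And>x. x \<in> space (Pi\<^sub>M I N) \<Longrightarrow> \<bar>f x\<bar> \<le> B"
    and diff: "\<And>i x y. i \<in> I \<Longrightarrow> x \<in> space (Pi\<^sub>M I N) \<Longrightarrow> y \<in> space (N i) \<Longrightarrow>
           \<bar>f (x(i := y)) - f x\<bar> \<le> c i"
    and t: "t > 0"
  shows "measure (Pi\<^sub>M I N) {x \<in> space (Pi\<^sub>M I N). f x - (\<integral>x. f x \<partial>Pi\<^sub>M I N) \<ge> t}
         \<le> exp_neg_quot (2 * t\<^sup>2) (\<Sum>i\<in>I. (c i)\<^sup>2)" (is "?p \<le> exp_neg_quot _ ?V")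
proof -
  interpret P: prob_space "Pi\<^sub>M I N" by (rule prob_space_PiM) (rule N)
  let ?g = "\<lambda>x. f x - (\<integral>x. f x \<partial>Pi\<^sub>M I N)"
  have chernoff: "?p \<le> exp (- s * t + s\<^sup>2 * ?V / 8)" if s: "s > 0" for s
  proof -
    have "ennreal ?p = emeasure (Pi\<^sub>M I N) {x \<in> space (Pi\<^sub>M I N). ?g x \<ge> t}"
      by (rule P.emeasure_eq_measure[symmetric])
    also have "\<dots> \<le> ennreal (exp (- s * t)) *
        (\<integral>\<^sup>+x\<in>space (Pi\<^sub>M I N). exp (s * ?g x) \<partial>Pi\<^sub>M I N)"
      by (rule Chernoff_ineq_nn_integral_ge[OF s]) measurable
    also have "(\<integral>\<^sup>+x\<in>space (Pi\<^sub>M I N). exp (s * ?g x) \<partial>Pi\<^sub>M I N)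
        = (\<integral>\<^sup>+x. exp (s * ?g x) \<partial>Pi\<^sub>M I N)"
      by (rule nn_integral_cong) simp
    also have "ennreal (exp (- s * t)) * \<dots> \<le> ennreal (exp (- s * t)) * exp (s\<^sup>2 * ?V / 8)"
      by (intro mult_left_mono nn_integral_exp_bounded_differences[OF N I f bdd diff s]) auto
    also have "\<dots> = exp (- s * t + s\<^sup>2 * ?V / 8)"
      by (simp add: ennreal_mult[symmetric] exp_add[symmetric])
    finally show ?thesis by simp
  qed
  show ?thesis
  proof (cases "?V = 0")
    case True
    \<comment> \<open>Without the quadratic term the bound is \<open>exp (- s * t)\<close>, which
      tends to 0 and forces probability zero, the value of \<open>exp_neg_quot\<close> at 0.\<close>
    have "((\<lambda>s. exp (- s * t)) \<longlongrightarrow> 0) at_top"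
      using t by real_asymp
    moreover have "eventually (\<lambda>s. ?p \<le> exp (- s * t)) at_top"
      using eventually_gt_at_top[of 0] by eventually_elim (use chernoff True in auto)
    ultimately have "?p \<le> 0"
      by (intro tendsto_lowerbound[of "\<lambda>s. exp (- s * t)" 0 at_top]) auto
    then show ?thesis using True by (simp add: exp_neg_quot_def)
  next
    case False
    moreover have "?V \<ge> 0" by (simp add: sum_nonneg)
    ultimately have V: "?V > 0" by simp
    \<comment> \<open>The choice \<open>s = 4 * t / ?V\<close> minimises the quadratic exponent in
      \<open>s\<close>.\<close>
    have "?p \<le> exp (- (4 * t / ?V) * t + (4 * t / ?V)\<^sup>2 * ?V / 8)"
      using V t by (intro chernoff) simp
    also have "- (4 * t / ?V) * t + (4 * t / ?V)\<^sup>2 * ?V / 8 = - (2 * t\<^sup>2) / ?V"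
      using V by (simp add: field_simps power2_eq_square)
    finally show ?thesis using V by (simp add: exp_neg_quot_def)
  qed
qed

section \<open>Measurability of Lipschitz functions\<close>

lemma psi_lipschitz_measurable:
  assumes diffeo: "diffeomorphism E borel \<psi>"
    and lip: "psi_lipschitz n E \<psi> L f"
  shows "f \<in> borel_measurable (Pi\<^sub>M {1..n} (\<lambda>_. E))"
proof -
  let ?\<phi> = "inv_into (space E) \<psi>"
  \<comment> \<open>This is \<open>f\<close> read in the coordinates given by \<open>\<psi>\<close>.
    It takes all real sequences, since for the countable index set of all naturals the product of
    the Borel sigma-algebras is the Borel sigma-algebra of the product topology.\<close>
  define q where "q u = f (\<lambda>i\<in>{1..n}. ?\<phi> (u i))" for u :: "nat \<Rightarrow> real"
  have [measurable]: "\<psi> \<in> borel_measurable E" and bij: "bij_betw \<psi> (space E) UNIV"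
    using diffeo by (auto simp: diffeomorphism_def)
  have \<phi>: "?\<phi> r \<in> space E" "\<psi> (?\<phi> r) = r" for r
    using bij by (auto simp: bij_betw_def inv_into_into f_inv_into_f)
  have q: "\<bar>q u - q v\<bar> \<le> L * L2_set (\<lambda>i. u i - v i) {1..n}" for u v
  proof -
    have "\<bar>q u - q v\<bar> \<le> L * L2_set (\<lambda>i. \<psi> ((\<lambda>i\<in>{1..n}. ?\<phi> (u i)) i) -
        \<psi> ((\<lambda>i\<in>{1..n}. ?\<phi> (v i)) i)) {1..n}"
      unfolding q_def
      by (rule lip[unfolded psi_lipschitz_def, rule_format]) (auto simp: space_PiM \<phi>(1))
    also have "\<dots> = L * L2_set (\<lambda>i. u i - v i) {1..n}"
      by (intro arg_cong2[where f = "(*)"] L2_set_cong refl) (simp add: \<phi>(2))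
    finally show ?thesis .
  qed
  \<comment> \<open>The Lipschitz bound involves finitely many coordinates, each continuous in the
    product topology, so it tends to 0 as \<open>u\<close> approaches \<open>v\<close>.\<close>
  have "continuous_on UNIV q"
  proof (rule continuous_at_imp_continuous_on, rule ballI)
    fix v :: "nat \<Rightarrow> real"
    have coord: "((\<lambda>u. u i) \<longlongrightarrow> v i) (at v)" for i
      using continuous_on_product_coordinates[of i] by (auto simp: continuous_on_def)
    have "((\<lambda>u. L * sqrt (\<Sum>i=1..n. (u i - v i)\<^sup>2)) \<longlongrightarrow>
        L * sqrt (\<Sum>i=1..n. (v i - v i)\<^sup>2)) (at v)"
      by (intro tendsto_intros coord)
    then have "((\<lambda>u. L * L2_set (\<lambda>i. u i - v i) {1..n}) \<longlongrightarrow> 0) (at v)"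
      by (simp add: L2_set_def)
    then have "((\<lambda>u. q u - q v) \<longlongrightarrow> 0) (at v)"
      by (rule Lim_null_comparison[rotated]) (use q in auto)
    then show "isCont q v"
      by (simp add: isCont_def LIM_zero_iff)
  qed
  then have "q \<in> borel_measurable borel"
    by (rule borel_measurable_continuous_onI)
  then have [measurable]: "q \<in> borel_measurable (Pi\<^sub>M UNIV (\<lambda>_::nat. borel))"
    using measurable_cong_sets[OF sets_PiM_equal_borel refl] by blast
  \<comment> \<open>Padding with 0 outside \<open>{1..n}\<close> is harmless because
    \<open>q\<close> reads only the coordinates in \<open>{1..n}\<close>.\<close>
  have [measurable]: "(\<lambda>x i. if i \<in> {1..n} then \<psi> (x i) else 0)
      \<in> measurable (Pi\<^sub>M {1..n} (\<lambda>_. E)) (Pi\<^sub>M UNIV (\<lambda>_::nat. borel))"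
  proof (rule measurable_PiM_single')
    fix i :: nat
    show "(\<lambda>x. if i \<in> {1..n} then \<psi> (x i) else 0) \<in> borel_measurable (Pi\<^sub>M {1..n} (\<lambda>_. E))"
      by (cases "i \<in> {1..n}") (simp_all del: atLeastAtMost_iff)
  qed (simp add: space_PiM)
  have "(\<lambda>x. q (\<lambda>i. if i \<in> {1..n} then \<psi> (x i) else 0)) \<in> borel_measurable (Pi\<^sub>M {1..n} (\<lambda>_. E))"
    by measurable
  also have "?this \<longleftrightarrow> ?thesis"
  proof (rule measurable_cong)
    fix x assume x: "x \<in> space (Pi\<^sub>M {1..n} (\<lambda>_. E))"
    have "(\<lambda>i\<in>{1..n}. ?\<phi> (if i \<in> {1..n} then \<psi> (x i) else 0)) = x"
    proof
      fix i
      show "(\<lambda>i\<in>{1..n}. ?\<phi> (if i \<in> {1..n} then \<psi> (x i) else 0)) i = x i"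
        using x bij by (cases "i \<in> {1..n}")
          (auto simp: space_PiM PiE_def extensional_def bij_betw_def Pi_def inv_into_f_f)
    qed
    then show "q (\<lambda>i. if i \<in> {1..n} then \<psi> (x i) else 0) = f x"
      by (simp add: q_def)
  qed
  finally show ?thesis .
qed

section \<open>Reduction to bounded differences by clamping\<close>

theorem theorem3p1:
  fixes M :: "'a measure" and E :: "'e measure" and \<mu> :: "nat \<Rightarrow> 'e measure"
    and X :: "nat \<Rightarrow> 'a \<Rightarrow> 'e" and \<psi> :: "'e \<Rightarrow> real" and f :: "(nat \<Rightarrow> 'e) \<Rightarrow> real"
    and a b :: "nat \<Rightarrow> real" and L t :: real and n :: nat
  assumes "prob_space M"
    and "prob_space.indep_vars M (\<lambda>_. E) X {1..n}"
    and "\<And>i. i \<in> {1..n} \<Longrightarrow> distr M E (X i) = \<mu> i"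
    and "diffeomorphism E borel \<psi>"
    and "\<And>i. i \<in> {1..n} \<Longrightarrow> AE \<omega> in M. \<psi> (X i \<omega>) \<in> {a i..b i}"
    and "psi_lipschitz n E \<psi> L f"
    and "t > 0"
  shows "measure M {\<omega> \<in> space M.
           f (\<lambda>i\<in>{1..n}. X i \<omega>) - (LINT \<omega>'|M. f (\<lambda>i\<in>{1..n}. X i \<omega>')) \<ge> t}
         \<le> exp_neg_quot (2 * t\<^sup>2) (L\<^sup>2 * (\<Sum>i=1..n. (b i - a i)\<^sup>2))"
proof (cases "n = 0")
  \<comment> \<open>For \<open>n = 0\<close> the argument of \<open>f\<close> is constant, so the
    deviation is 0 and the event is empty as \<open>t > 0\<close>.\<close>
  case True
  interpret prob_space M by fact
  show ?thesis
    using \<open>t > 0\<close> True by (simp add: exp_neg_quot_def prob_space restrict_def)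
next
  case False
  interpret prob_space M by fact
  let ?I = "{1..n}" and ?\<phi> = "inv_into (space E) \<psi>"
  let ?P = "Pi\<^sub>M ?I (\<lambda>_. E)"
  have X [measurable]: "X i \<in> measurable M E" if "i \<in> ?I" for i
    using assms(2) that by (auto simp: indep_vars_def)
  have ab: "a i \<le> b i" if "i \<in> ?I" for i
  proof -
    \<comment> \<open>The interval contains a value almost surely, so it is nonempty; an almost sure
      statement free of \<open>\<omega>\<close> is true in a probability space.\<close>
    have "AE \<omega> in M. a i \<le> b i"
      using assms(5)[OF that] by eventually_elim auto
    then show ?thesis by simp
  qed
  have [measurable]: "\<psi> \<in> borel_measurable E" "?\<phi> \<in> measurable borel E"
    and bij: "bij_betw \<psi> (space E) UNIV"
    using assms(4) by (auto simp: diffeomorphism_def)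
  have \<phi>: "?\<phi> r \<in> space E" "\<psi> (?\<phi> r) = r" for r
    using bij by (auto simp: bij_betw_def inv_into_into f_inv_into_f)
  have [measurable]: "f \<in> borel_measurable ?P"
    by (rule psi_lipschitz_measurable) fact+
  define clamp where "clamp i r = min (b i) (max (a i) r)" for i and r :: real
  have clamp_mem: "clamp i r \<in> {a i..b i}" if "i \<in> ?I" for i r
    using ab[OF that] by (auto simp: clamp_def)
  have [measurable]: "clamp i \<in> borel_measurable borel" for i
    unfolding clamp_def by measurable
  \<comment> \<open>Clamping happens on the real line and is carried back to \<open>E\<close> by the
    inverse of \<open>\<psi>\<close>. Surjectivity of \<open>\<psi>\<close> puts \<open>C x\<close>
    in the product space for every \<open>x\<close> whatsoever.\<close>
  define C where "C x = (\<lambda>i\<in>?I. ?\<phi> (clamp i (\<psi> (x i))))" for x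
  have C_space: "C x \<in> space ?P" for x
    using \<phi> by (auto simp: C_def space_PiM)
  have [measurable]: "C \<in> measurable ?P ?P"
    unfolding C_def by measurable
  have lip: "\<bar>f (C x) - f (C y)\<bar> \<le> \<bar>L\<bar> * L2_set (\<lambda>i. clamp i (\<psi> (x i)) - clamp i (\<psi> (y i))) ?I"
    for x y
  proof -
    have "\<bar>f (C x) - f (C y)\<bar> \<le> L * L2_set (\<lambda>i. \<psi> (C x i) - \<psi> (C y i)) ?I"
      using assms(6) C_space unfolding psi_lipschitz_def by blast
    \<comment> \<open>The sign of \<open>L\<close> is not prescribed; with
      \<open>\<bar>L\<bar>\<close> the later estimates of the norm can be multiplied
      through.\<close>
    also have "\<dots> \<le> \<bar>L\<bar> * L2_set (\<lambda>i. \<psi> (C x i) - \<psi> (C y i)) ?I"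
      by (intro mult_right_mono) (auto simp: L2_set_nonneg)
    also have "L2_set (\<lambda>i. \<psi> (C x i) - \<psi> (C y i)) ?I
        = L2_set (\<lambda>i. clamp i (\<psi> (x i)) - clamp i (\<psi> (y i))) ?I"
      by (rule L2_set_cong) (auto simp: C_def \<phi>(2))
    finally show ?thesis .
  qed
  have clamp_diff: "(clamp i r - clamp i s)\<^sup>2 \<le> (b i - a i)\<^sup>2" if "i \<in> ?I" for i r s
    using clamp_mem[OF that, of r] clamp_mem[OF that, of s]
    by (intro power2_le_iff_abs_le[THEN iffD2]) auto
  \<comment> \<open>\<open>X\<close> is unconstrained outside \<open>{1..n}\<close>, while \<open>bounded_differences_tail\<close> needs a probability measure
    at every index.\<close>
  define N where "N i = distr M E (X (if i \<in> ?I then i else 1))" for i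
  have N: "prob_space (N i)" for i
    unfolding N_def using False by (intro prob_space_distr X) auto
  have PN: "distr M ?P (\<lambda>\<omega>. \<lambda>i\<in>?I. X i \<omega>) = Pi\<^sub>M ?I N"
  proof -
    \<comment> \<open>Independence says exactly that the joint law is the product of the marginal
      laws.\<close>
    have "distr M ?P (\<lambda>\<omega>. \<lambda>i\<in>?I. X i \<omega>) = Pi\<^sub>M ?I (\<lambda>i. distr M E (X i))"
      using assms(2) False by (subst indep_vars_iff_distr_eq_PiM'[symmetric]) auto
    also have "\<dots> = Pi\<^sub>M ?I N"
      by (rule PiM_cong) (auto simp: N_def)
    finally show ?thesis .
  qed
  have space_N: "space (Pi\<^sub>M ?I N) = space ?P"
    using PN[symmetric] by simp
  have [measurable]: "(\<lambda>\<omega>. \<lambda>i\<in>?I. X i \<omega>) \<in> measurable M ?P"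
    by measurable
  have AE: "AE \<omega> in M. f (C (\<lambda>i\<in>?I. X i \<omega>)) = f (\<lambda>i\<in>?I. X i \<omega>)"
  proof -
    have "AE \<omega> in M. \<forall>i\<in>?I. \<psi> (X i \<omega>) \<in> {a i..b i}"
      using assms(5) by (intro AE_finite_allI) auto
    then show ?thesis
      using AE_space
    proof eventually_elim
      case (elim \<omega>)
      have "C (\<lambda>i\<in>?I. X i \<omega>) = (\<lambda>i\<in>?I. X i \<omega>)"
        unfolding C_def
      proof (rule restrict_ext)
        fix i assume i: "i \<in> ?I"
        then have "clamp i (\<psi> (X i \<omega>)) = \<psi> (X i \<omega>)"
          using elim(1) by (auto simp: clamp_def)
        moreover have "X i \<omega> \<in> space E"
          using measurable_space[OF X[OF i] elim(2)] .
        ultimately show "?\<phi> (clamp i (\<psi> ((\<lambda>i\<in>?I. X i \<omega>) i))) = X i \<omega>"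
          using i bij by (simp add: bij_betw_def inv_into_f_f)
      qed
      then show ?case by simp
    qed
  qed
  let ?F = "\<lambda>x. f (C x)"
  have expect: "(LINT \<omega>|M. f (\<lambda>i\<in>?I. X i \<omega>)) = (\<integral>x. ?F x \<partial>Pi\<^sub>M ?I N)"
  proof -
    have "(LINT \<omega>|M. f (\<lambda>i\<in>?I. X i \<omega>)) = (LINT \<omega>|M. ?F (\<lambda>i\<in>?I. X i \<omega>))"
      using AE by (intro integral_cong_AE) (auto simp del: One_nat_def elim: eventually_mono)
    also have "\<dots> = (\<integral>x. ?F x \<partial>Pi\<^sub>M ?I N)"
      unfolding PN[symmetric] by (rule integral_distr[symmetric]) measurable
    finally show ?thesis .
  qed
  define e where "e = (\<integral>x. ?F x \<partial>Pi\<^sub>M ?I N)"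
  have "measure M {\<omega> \<in> space M. f (\<lambda>i\<in>?I. X i \<omega>) - e \<ge> t}
      = measure M {\<omega> \<in> space M. ?F (\<lambda>i\<in>?I. X i \<omega>) - e \<ge> t}"
    using AE by (intro finite_measure_eq_AE) (auto simp del: One_nat_def)
  also have "\<dots> = measure (Pi\<^sub>M ?I N) {x \<in> space (Pi\<^sub>M ?I N). ?F x - e \<ge> t}"
  proof -
    have "measure (distr M ?P (\<lambda>\<omega>. \<lambda>i\<in>?I. X i \<omega>)) {x \<in> space ?P. ?F x - e \<ge> t}
        = measure M ((\<lambda>\<omega>. \<lambda>i\<in>?I. X i \<omega>) -` {x \<in> space ?P. ?F x - e \<ge> t} \<inter> space M)"
      by (rule measure_distr) measurable
    also have "(\<lambda>\<omega>. \<lambda>i\<in>?I. X i \<omega>) -` {x \<in> space ?P. ?F x - e \<ge> t} \<inter> space M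
        = {\<omega> \<in> space M. ?F (\<lambda>i\<in>?I. X i \<omega>) - e \<ge> t}"
      using measurable_space[OF X] by (auto simp: space_PiM)
    finally show ?thesis
      unfolding PN space_N by simp
  qed
  also have "\<dots> \<le> exp_neg_quot (2 * t\<^sup>2) (\<Sum>i\<in>?I. (\<bar>L\<bar> * (b i - a i))\<^sup>2)"
    unfolding e_def
  proof (rule bounded_differences_tail[OF N _ _ _ _ \<open>t > 0\<close>])
    show "?F \<in> borel_measurable (Pi\<^sub>M ?I N)"
      unfolding PN[symmetric] by (simp del: One_nat_def)
    \<comment> \<open>Any reference point serves, even one outside the product space, since
      \<open>lip\<close> holds for all arguments after clamping.\<close>
    define x0 :: "nat \<Rightarrow> 'e" where "x0 = (\<lambda>_. undefined)"
    show "\<bar>?F x\<bar> \<le> \<bar>?F x0\<bar> + \<bar>L\<bar> * L2_set (\<lambda>i. b i - a i) ?I" for x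
    proof -
      have "L2_set (\<lambda>i. clamp i (\<psi> (x i)) - clamp i (\<psi> (x0 i))) ?I \<le> L2_set (\<lambda>i. b i - a i) ?I"
        unfolding L2_set_def by (intro real_sqrt_le_mono sum_mono clamp_diff)
      then have "\<bar>?F x - ?F x0\<bar> \<le> \<bar>L\<bar> * L2_set (\<lambda>i. b i - a i) ?I"
        by (intro order_trans[OF lip] mult_left_mono) auto
      then show ?thesis by linarith
    qed
    show "\<bar>?F (x(i := y)) - ?F x\<bar> \<le> \<bar>L\<bar> * (b i - a i)" if i: "i \<in> ?I" for i x y
    proof -
      \<comment> \<open>Only the term \<open>j = i\<close> survives an update at \<open>i\<close>,
        and clamping bounds it by the squared length of the interval.\<close>
      have "(\<Sum>j\<in>?I. (clamp j (\<psi> ((x(i := y)) j)) - clamp j (\<psi> (x j)))\<^sup>2)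
          \<le> (\<Sum>j\<in>?I. if j = i then (b i - a i)\<^sup>2 else 0)"
        by (intro sum_mono) (auto simp: clamp_diff[OF i])
      also have "\<dots> = (b i - a i)\<^sup>2"
        using i by simp
      finally have "L2_set (\<lambda>j. clamp j (\<psi> ((x(i := y)) j)) - clamp j (\<psi> (x j))) ?I \<le> b i - a i"
        unfolding L2_set_def using ab[OF i] by (intro real_le_lsqrt) auto
      then show ?thesis
        by (intro order_trans[OF lip] mult_left_mono) auto
    qed
  qed simp
  also have "(\<Sum>i\<in>?I. (\<bar>L\<bar> * (b i - a i))\<^sup>2) = L\<^sup>2 * (\<Sum>i\<in>?I. (b i - a i)\<^sup>2)"
    by (simp add: power_mult_distrib sum_distrib_left)
  finally show ?thesis unfolding expect e_def .
qed

end
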